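(* Let $\Omega\subset\mathbb{H}$ be open and let $u:\Omega\to\mathbb{R}$ be a function in $\Gamma^{0,1}_{\mathrm{loc}}(\Omega)$. Then, for every compact set $K\subset\Omega$, the set $\partial_H u(K)\subset V_1$ is compact.
   Context: The Heisenberg group $\mathbb{H}$ is $\mathbb{R}^3$ with the group law $(x,y,t)(x',y',t')=(x+x',\,y+y',\,t+t'+2(x'y-xy'))$ and identity $e=(0,0,0)$. Let $X=\partial_x+2y\,\partial_t$, $Y=\partial_y-2x\,\partial_t$ and $V_1=\mathrm{span}\{X,Y\}\cong\mathbb{R}^2$, with the inner product $\langle\cdot,\cdot\rangle$ for which $X,Y$ are orthonormal. Let $\xi_1(x,y,t)=xX+yY\in V_1$. For $g_0=(x_0,y_0,t_0)\in\mathbb{H}$ the horizontal plane at $g_0$ is $H_{g_0}=\{(x,y,t): t=t_0+2y_0x-2x_0y\}$. Let $\rho(x,y,t)=((x^2+y^2)^2+t^2)^{1/4}$ and $\rho(g,g')=\rho(g^{-1}g')$. The class $\Gamma^{0,1}_{\mathrm{loc}}(\Omega)$ consists of the locally Lipschitz functions: every $g\in\Omega$ has a neighborhood $B_g\subset\Omega$ and a constant $L_g>0$ with $|u(g'')-u(g')|\le L_g\,\rho(g'',g')$ for all $g',g''\in B_g$. The H-subdifferential of $u$ at $g_0\in\Omega$ is $\partial_H u(g_0)=\{p\in V_1:\ u(g)\ge u(g_0)+\langle p,\xi_1(g)-\xi_1(g_0)\rangle\ \ \forall g\in H_{g_0}\cap\Omega\}$, and for $E\subset\Omega$ the H-normal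 map is $\partial_H u(E)=\bigcup_{g\in E}\partial_H u(g)$. *)

theory Defs
  imports "HOL-Analysis.Analysis"
begin

text \<open>Points of the Heisenberg group are triples \<open>(x, y, t)\<close>. The type carries the Euclidean
  topology, which is also the topology of the gauge distance below. The operations \<open>+\<close> and \<open>-\<close>
  of the type are componentwise and are not the group operations.\<close>

type_synonym heis = "real \<times> real \<times> real"

definition heis_mult :: "heis \<Rightarrow> heis \<Rightarrow> heis" where
  "heis_mult = (\<lambda>(x, y, t) (x', y', t'). (x + x', y + y', t + t' + 2 * (x' * y - x * y')))"

definition heis_e :: heis where
  "heis_e = (0, 0, 0)"

definition heis_inv :: "heis \<Rightarrow> heis" where
  "heis_inv = (\<lambda>(x, y, t). (- x, - y, - t))"

lemma heis_mult_assoc: "heis_mult (heis_mult g h) k = heis_mult g (heis_mult h k)"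
  by (auto simp: heis_mult_def algebra_simps split: prod.splits)

lemma heis_mult_e: "heis_mult heis_e g = g" "heis_mult g heis_e = g"
  by (auto simp: heis_mult_def heis_e_def split: prod.splits)

lemma heis_mult_inv: "heis_mult (heis_inv g) g = heis_e" "heis_mult g (heis_inv g) = heis_e"
  by (auto simp: heis_mult_def heis_inv_def heis_e_def split: prod.splits)

text \<open>The pair \<open>(a, b)\<close> stands for the left-invariant vector field \<open>a X + b Y\<close> with
  \<open>X = \<partial>\<^sub>x + 2 y \<partial>\<^sub>t\<close> and \<open>Y = \<partial>\<^sub>y - 2 x \<partial>\<^sub>t\<close>. As \<open>X, Y\<close> are orthonormal for the inner product of
  \<open>V\<^sub>1 = span {X, Y}\<close>, that inner product and its topology are the standard ones of the type.\<close>

type_synonym horizontal_layer = "real \<times> real"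

definition xi1 :: "heis \<Rightarrow> horizontal_layer" where
  "xi1 = (\<lambda>(x, y, t). (x, y))"

definition horizontal_plane :: "heis \<Rightarrow> heis set" where
  "horizontal_plane = (\<lambda>(x0, y0, t0). {(x, y, t). t = t0 + 2 * y0 * x - 2 * x0 * y})"

definition gauge_rho :: "heis \<Rightarrow> real" where
  "gauge_rho = (\<lambda>(x, y, t). root 4 ((x\<^sup>2 + y\<^sup>2)\<^sup>2 + t\<^sup>2))"

definition gauge_dist :: "heis \<Rightarrow> heis \<Rightarrow> real" where
  "gauge_dist g g' = gauge_rho (heis_mult (heis_inv g) g')"

text \<open>A function \<open>u : \<Omega> \<rightarrow> \<real>\<close> is given by a total function of which only the values on \<open>\<Omega>\<close>
  are used.\<close>

definition Gamma01_loc :: "heis set \<Rightarrow> (heis \<Rightarrow> real) set" where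
  "Gamma01_loc \<Omega> = {u. \<forall>g\<in>\<Omega>. \<exists>B L. open B \<and> g \<in> B \<and> B \<subseteq> \<Omega> \<and> L > 0 \<and>
     (\<forall>g'\<in>B. \<forall>g''\<in>B. \<bar>u g'' - u g'\<bar> \<le> L * gauge_dist g'' g')}"

definition H_subdiff :: "heis set \<Rightarrow> (heis \<Rightarrow> real) \<Rightarrow> heis \<Rightarrow> horizontal_layer set" where
  "H_subdiff \<Omega> u g0 =
     {p. \<forall>g \<in> horizontal_plane g0 \<inter> \<Omega>. u g \<ge> u g0 + p \<bullet> (xi1 g - xi1 g0)}"

definition H_normal_map :: "heis set \<Rightarrow> (heis \<Rightarrow> real) \<Rightarrow> heis set \<Rightarrow> horizontal_layer set" where
  "H_normal_map \<Omega> u E = (\<Union>g\<in>E. H_subdiff \<Omega> u g)"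

end

theory Submission
  imports Defs
begin

text \<open>Moving from \<open>g\<close> along the horizontal direction \<open>p\<close> itself stays in the horizontal plane
  at \<open>g\<close>, so the subdifferential inequality together with the Lipschitz bound gives
  \<open>s |p|\<^sup>2 \<le> L s |p|\<close> for small \<open>s > 0\<close>: subgradients are bounded by the local Lipschitz constant.
  Moreover the graph of the subdifferential is closed, because every point of the horizontal plane
  at \<open>g\<close> is the limit of the points over the same \<open>(x, y)\<close> in the horizontal planes at points
  converging to \<open>g\<close>. Sequential compactness follows.\<close>

lemma continuous_on_gauge_dist: "continuous_on UNIV (\<lambda>g. gauge_dist g h)"
  unfolding gauge_dist_def gauge_rho_def heis_mult_def heis_inv_def case_prod_beta
  by (intro continuous_intros)

lemma gauge_dist_self: "gauge_dist g g = 0"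
  by (simp add: gauge_dist_def heis_mult_inv) (simp add: gauge_rho_def heis_e_def)

lemma Gamma01_locE:
  assumes "u \<in> Gamma01_loc \<Omega>" and "g \<in> \<Omega>"
  obtains B L where "open B" "g \<in> B" "B \<subseteq> \<Omega>" "L > 0"
    "\<forall>g'\<in>B. \<forall>g''\<in>B. \<bar>u g'' - u g'\<bar> \<le> L * gauge_dist g'' g'"
  using assms unfolding Gamma01_loc_def by auto

text \<open>The gauge distance to a fixed point is continuous in the Euclidean topology and vanishes
  at that point, so the local Lipschitz bound squeezes \<open>u h - u g\<close> to 0.\<close>

lemma Gamma01_loc_continuous_on:
  assumes "u \<in> Gamma01_loc \<Omega>"
  shows "continuous_on \<Omega> u"
proof -
  have "isCont u g" if "g \<in> \<Omega>" for g
  proof -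
    from assms that obtain B L where B: "open B" "g \<in> B" "B \<subseteq> \<Omega>" "L > 0"
      and lip: "\<forall>g'\<in>B. \<forall>g''\<in>B. \<bar>u g'' - u g'\<bar> \<le> L * gauge_dist g'' g'"
      by (rule Gamma01_locE)
    have "isCont (\<lambda>h. gauge_dist h g) g"
      using continuous_on_gauge_dist[of g]
      by (simp add: continuous_on_eq_continuous_at del: split_paired_All)
    then have "(\<lambda>h. L * gauge_dist h g) \<midarrow>g\<rightarrow> 0"
      by (auto simp: isCont_def gauge_dist_self intro: tendsto_mult_right_zero)
    moreover have "\<forall>\<^sub>F h in at g. norm (u h - u g) \<le> L * gauge_dist h g"
      using eventually_at_in_open'[OF B(1,2)] by eventually_elim (simp add: lip B)
    ultimately have "(\<lambda>h. u h - u g) \<midarrow>g\<rightarrow> 0"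
      by (rule Lim_null_comparison[rotated])
    then show ?thesis
      by (simp add: isCont_def LIM_zero_iff)
  qed
  then show ?thesis
    by (simp add: continuous_at_imp_continuous_on)
qed

text \<open>Right multiplication by \<open>(v, 0)\<close> follows the integral curve of the
  left-invariant field \<open>v\<close> from \<open>g\<close> for unit time; it parametrises the
  horizontal plane at \<open>g\<close> by the horizontal layer.\<close>

definition horizontal_shift :: "heis \<Rightarrow> horizontal_layer \<Rightarrow> heis" where
  "horizontal_shift g v = heis_mult g (fst v, snd v, 0)"

lemma horizontal_shift_in_plane: "horizontal_shift g v \<in> horizontal_plane g"
  by (auto simp: horizontal_shift_def heis_mult_def horizontal_plane_def algebra_simps
      split: prod.splits)

lemma xi1_horizontal_shift: "xi1 (horizontal_shift g v) - xi1 g = v"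
  by (auto simp: horizontal_shift_def heis_mult_def xi1_def split: prod.splits)

lemma horizontal_shift_0: "horizontal_shift g 0 = g"
  by (auto simp: horizontal_shift_def heis_mult_def split: prod.splits)

lemma continuous_on_horizontal_shift: "continuous_on UNIV (horizontal_shift g)"
  unfolding horizontal_shift_def heis_mult_def case_prod_beta
  by (intro continuous_intros)

text \<open>By the group law the factor \<open>g\<close> cancels and the inverse of
  \<open>(v, 0)\<close> is left, whose gauge is the Euclidean norm since its last coordinate is 0.
  Hence the Lipschitz bound is linear in the step length along horizontal directions.\<close>

lemma gauge_dist_horizontal_shift: "gauge_dist (horizontal_shift g v) g = norm v"
proof -
  have "heis_mult (heis_inv (horizontal_shift g v)) g = (- fst v, - snd v, 0)"
    by (auto simp: horizontal_shift_def heis_mult_def heis_inv_def algebra_simps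
        split: prod.splits)
  moreover have "((fst v)\<^sup>2 + (snd v)\<^sup>2)\<^sup>2 = norm v ^ 4"
    using power_mult[of "norm v" 2 2] by (simp add: norm_prod_def)
  ultimately show ?thesis
    by (simp add: gauge_dist_def gauge_rho_def real_root_power_cancel)
qed

text \<open>The bound \<open>L\<close> is the same for all base points in \<open>B\<close>, which is
  what makes it usable along a sequence of base points.\<close>

lemma H_subdiff_norm_le:
  assumes p: "p \<in> H_subdiff \<Omega> u g" and B: "open B" "g \<in> B" "B \<subseteq> \<Omega>" and "L > 0"
    and lip: "\<forall>g'\<in>B. \<forall>g''\<in>B. \<bar>u g'' - u g'\<bar> \<le> L * gauge_dist g'' g'"
  shows "norm p \<le> L"
proof (cases "p = 0")
  case True
  with \<open>L > 0\<close> show ?thesis by simp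
next
  case False
  have "isCont (horizontal_shift g) (0 *\<^sub>R p)"
    using continuous_on_horizontal_shift[of g]
    by (simp add: continuous_on_eq_continuous_at del: split_paired_All)
  then have "((\<lambda>s. horizontal_shift g (s *\<^sub>R p)) \<longlongrightarrow> horizontal_shift g (0 *\<^sub>R p)) (at_right 0)"
    by (rule isCont_tendsto_compose) (intro tendsto_intros)
  then have "\<forall>\<^sub>F s in at_right 0. horizontal_shift g (s *\<^sub>R p) \<in> B"
    using B(1,2) by (simp add: horizontal_shift_0 topological_tendstoD)
  then have "\<forall>\<^sub>F s in at_right 0. horizontal_shift g (s *\<^sub>R p) \<in> B \<and> (0::real) < s"
    using eventually_at_right_less by (rule eventually_conj)
  then obtain s :: real where s: "horizontal_shift g (s *\<^sub>R p) \<in> B" "0 < s"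
    using eventually_happens'[OF trivial_limit_at_right_real] by blast
  define h where "h = horizontal_shift g (s *\<^sub>R p)"
  have "u h \<ge> u g + p \<bullet> (xi1 h - xi1 g)"
    using p s(1) \<open>B \<subseteq> \<Omega>\<close> horizontal_shift_in_plane[of g "s *\<^sub>R p"]
    unfolding H_subdiff_def h_def by auto
  then have "u h \<ge> u g + s * (norm p * norm p)"
    by (simp add: h_def xi1_horizontal_shift power2_norm_eq_inner[symmetric] power2_eq_square)
  moreover have "\<bar>u h - u g\<bar> \<le> L * (s * norm p)"
    using lip \<open>g \<in> B\<close> s gauge_dist_horizontal_shift[of g "s *\<^sub>R p"] by (force simp: h_def)
  ultimately have "s * (norm p * norm p) \<le> L * (s * norm p)"
    by linarith
  \<comment> \<open>The common factor \<open>s * norm p\<close> is positive because \<open>p\<close>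
    is nonzero, so it cancels.\<close>
  then have "(s * norm p) * norm p \<le> (s * norm p) * L"
    by (simp add: mult_ac)
  then show ?thesis
    using \<open>0 < s\<close> False by simp
qed

lemma H_subdiff_closed_graph:
  assumes "open \<Omega>" and cont: "continuous_on \<Omega> u" and "g \<in> \<Omega>"
    and sub: "\<And>n::nat. p n \<in> H_subdiff \<Omega> u (G n)"
    and G: "G \<longlonglongrightarrow> g" and p: "p \<longlonglongrightarrow> q"
  shows "q \<in> H_subdiff \<Omega> u g"
  unfolding H_subdiff_def
proof safe
  fix h1 h2 h3
  assume plane: "(h1, h2, h3) \<in> horizontal_plane g" and "(h1, h2, h3) \<in> \<Omega>"
  let ?h = "(h1, h2, h3)"
  \<comment> \<open>The last coordinate solves the equation of the horizontal plane at
    \<open>k\<close> over \<open>(h1, h2)\<close>; it is affine in \<open>k\<close>, so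
    \<open>H (G n)\<close> tends to \<open>H g\<close>.\<close>
  define H where "H k = (h1, h2, snd (snd k) + 2 * fst (snd k) * h1 - 2 * fst k * h2)" for k :: heis
  have H_g: "H g = ?h"
    using plane by (auto simp: horizontal_plane_def H_def split: prod.splits)
  have H_plane: "H k \<in> horizontal_plane k" for k
    by (auto simp: horizontal_plane_def H_def split: prod.splits)
  have HG: "(\<lambda>n. H (G n)) \<longlonglongrightarrow> ?h"
    unfolding H_g[symmetric] H_def by (intro tendsto_intros G)
  have uHG: "(\<lambda>n. u (H (G n))) \<longlonglongrightarrow> u ?h"
    using cont \<open>open \<Omega>\<close> \<open>?h \<in> \<Omega>\<close> HG
    by (metis continuous_on_eq_continuous_at isCont_tendsto_compose)
  have uG: "(\<lambda>n. u (G n)) \<longlonglongrightarrow> u g"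
    using cont \<open>open \<Omega>\<close> \<open>g \<in> \<Omega>\<close> G
    by (metis continuous_on_eq_continuous_at isCont_tendsto_compose)
  \<comment> \<open>The subdifferential inequality at \<open>G n\<close> can be tested only at
    points of \<Omega>; openness puts \<open>H (G n)\<close> there for large
    \<open>n\<close>.\<close>
  have "\<forall>\<^sub>F n in sequentially. H (G n) \<in> \<Omega>"
    using HG \<open>open \<Omega>\<close> \<open>?h \<in> \<Omega>\<close> by (rule topological_tendstoD)
  then have ev: "\<forall>\<^sub>F n in sequentially.
      u (G n) + p n \<bullet> (xi1 (H (G n)) - xi1 (G n)) \<le> u (H (G n))"
    by eventually_elim (use sub H_plane in \<open>auto simp: H_subdiff_def\<close>)
  have xi1: "xi1 k = (fst k, fst (snd k))" for k
    by (simp add: xi1_def case_prod_beta)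
  have "(\<lambda>n. u (G n) + p n \<bullet> (xi1 (H (G n)) - xi1 (G n)))
      \<longlonglongrightarrow> u g + q \<bullet> (xi1 ?h - xi1 g)"
    unfolding xi1 by (intro tendsto_intros uG p HG G)
  then show "u g + q \<bullet> (xi1 ?h - xi1 g) \<le> u ?h"
    using tendsto_le[OF sequentially_bot uHG _ ev] by blast
qed

theorem theorem5p1:
  fixes \<Omega> :: "heis set" and u :: "heis \<Rightarrow> real" and K :: "heis set"
  assumes "open \<Omega>"
    and "u \<in> Gamma01_loc \<Omega>"
    and "compact K" and "K \<subseteq> \<Omega>"
  shows "compact (H_normal_map \<Omega> u K)"
  unfolding compact_def
proof (intro allI impI)
  fix p :: "nat \<Rightarrow> horizontal_layer"
  assume "\<forall>n. p n \<in> H_normal_map \<Omega> u K"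
  then have "\<forall>n. \<exists>g. g \<in> K \<and> p n \<in> H_subdiff \<Omega> u g"
    unfolding H_normal_map_def by blast
  then obtain G where G: "\<And>n. G n \<in> K" and sub: "\<And>n. p n \<in> H_subdiff \<Omega> u (G n)"
    by metis
  \<comment> \<open>Base points are extracted first: near their limit a single Lipschitz constant
    bounds the subgradients, so no uniform constant on \<open>K\<close> has to be found.\<close>
  obtain g r where "g \<in> K" and r: "strict_mono r" "(G \<circ> r) \<longlonglongrightarrow> g"
    using \<open>compact K\<close> G unfolding compact_def by metis
  with \<open>K \<subseteq> \<Omega>\<close> have "g \<in> \<Omega>" by blast
  with \<open>u \<in> Gamma01_loc \<Omega>\<close> obtain B L where B: "open B" "g \<in> B" "B \<subseteq> \<Omega>" "L > 0"
    and lip: "\<forall>g'\<in>B. \<forall>g''\<in>B. \<bar>u g'' - u g'\<bar> \<le> L * gauge_dist g'' g'"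
    by (rule Gamma01_locE)
  obtain N where N: "\<And>n. n \<ge> N \<Longrightarrow> G (r n) \<in> B"
    using topological_tendstoD[OF r(2) B(1,2)] by (auto simp: eventually_sequentially)
  \<comment> \<open>Dropping the first \<open>N\<close> terms puts every base point in
    \<open>B\<close>, so that all remaining subgradients lie in one closed ball, as sequential
    compactness of the ball requires.\<close>
  define r' where "r' n = r (n + N)" for n
  have r': "strict_mono r'"
    using r(1) by (simp add: strict_mono_def r'_def)
  have G_lim: "(\<lambda>n. G (r' n)) \<longlonglongrightarrow> g"
    using LIMSEQ_ignore_initial_segment[OF r(2), of N] by (simp add: r'_def)
  have "p (r' n) \<in> cball 0 L" for n
    using H_subdiff_norm_le[OF sub B(1) _ B(3,4) lip] N by (simp add: r'_def)
  then obtain q s where s: "strict_mono s" "(\<lambda>n. p (r' (s n))) \<longlonglongrightarrow> q"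
    using compact_cball[of "0::horizontal_layer" L, unfolded compact_def, rule_format,
        of "p \<circ> r'"]
    by (auto simp: o_def)
  have "(\<lambda>n. G (r' (s n))) \<longlonglongrightarrow> g"
    using LIMSEQ_subseq_LIMSEQ[OF G_lim s(1)] by (simp add: o_def)
  then have "q \<in> H_subdiff \<Omega> u g"
    using s(2) by (rule H_subdiff_closed_graph[OF \<open>open \<Omega>\<close>
        Gamma01_loc_continuous_on[OF assms(2)] \<open>g \<in> \<Omega>\<close> sub])
  with \<open>g \<in> K\<close> have "q \<in> H_normal_map \<Omega> u K"
    unfolding H_normal_map_def by blast
  then show "\<exists>l\<in>H_normal_map \<Omega> u K. \<exists>r. strict_mono r \<and> (p \<circ> r) \<longlonglongrightarrow> l"
    using strict_mono_o[OF r' s(1)] s(2) by (intro bexI[of _ q] exI[of _ "r' \<circ> s"]) (auto simp: o_def)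
qed

end
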